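(* Let $K$ be a field, $n\geq 1$, $S=K[x_1,\ldots,x_n]$, and let $I\subset S$ be a monomial ideal with $g(I)=3$. Then $\operatorname{sdepth}(I)=n-1$.
   Context: For a monomial ideal $I\subset S$, $G(I)$ denotes its set of minimal monomial generators and $g(I)=|G(I)|$. $S$ is given the standard $\mathbb{Z}^n$-grading, with $\deg x_i$ the $i$-th unit vector. Let $M\neq 0$ be a finitely generated $\mathbb{Z}^n$-graded $S$-module. A Stanley decomposition of $M$ is a direct sum decomposition of $K$-vector spaces $\mathcal{D}: M=\bigoplus_{i=1}^r m_iK[Z_i]$ where each $m_i\in M$ is homogeneous, $Z_i\subset\{x_1,\ldots,x_n\}$, and $m_iK[Z_i]$ is a free $K[Z_i]$-module. Put $\operatorname{sdepth}(\mathcal{D})=\min_{1\le i\le r}|Z_i|$. The Stanley depth of $M$ is $\operatorname{sdepth}(M)=\max\{\operatorname{sdepth}(\mathcal{D}) : \mathcal{D}\text{ a Stanley decomposition of }M\}$. *)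

theory Defs
  imports Complex_Main "HOL-Library.Poly_Mapping" "HOL-Library.Cardinality" "HOL-Library.FuncSet"
begin

section \<open>The polynomial ring\<close>

text \<open>
  The variables are indexed by a finite type \<open>'n\<close>, so that \<open>n = CARD('n) \<ge> 1\<close>. An exponent vector is
  an element of \<open>'n \<Rightarrow>\<^sub>0 nat\<close>, and multiplication on \<open>('n, 'k) mpoly\<close> is convolution.
\<close>

type_synonym ('n, 'k) mpoly = "('n \<Rightarrow>\<^sub>0 nat) \<Rightarrow>\<^sub>0 'k"

definition monomials :: "('n::finite, 'k::field) mpoly set" where
  "monomials = range (\<lambda>u. Poly_Mapping.single u 1)"

text \<open>The subring \<open>K[Z]\<close> for a set \<open>Z\<close> of variables.\<close>

definition polys_in :: "'n set \<Rightarrow> ('n::finite, 'k::field) mpoly set" where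
  "polys_in Z = {f. \<forall>u\<in>Poly_Mapping.keys f. Poly_Mapping.keys u \<subseteq> Z}"

text \<open>
  The component of degree \<open>a\<close> of the standard \<open>\<int>\<^sup>n\<close>-grading; it is zero if \<open>a\<close> has a negative entry.
\<close>

definition hom_comp :: "('n \<Rightarrow> int) \<Rightarrow> ('n::finite, 'k::field) mpoly set" where
  "hom_comp a = {f. \<forall>u\<in>Poly_Mapping.keys f. \<forall>i. int (Poly_Mapping.lookup u i) = a i}"


section \<open>Monomial ideals\<close>

text \<open>The ideal generated by a set \<open>A\<close> is the span of \<open>A\<close> in the ring regarded as a module over itself.\<close>

abbreviation ideal_gen :: "'a::comm_ring_1 set \<Rightarrow> 'a set" where
  "ideal_gen \<equiv> module.span (*)"

definition monomial_ideal :: "('n::finite, 'k::field) mpoly set \<Rightarrow> bool" where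
  "monomial_ideal I \<longleftrightarrow> (\<exists>A\<subseteq>monomials. ideal_gen A = I)"

definition is_min_mon_gens ::
    "('n::finite, 'k::field) mpoly set \<Rightarrow> ('n, 'k) mpoly set \<Rightarrow> bool" where
  "is_min_mon_gens I G \<longleftrightarrow>
     G \<subseteq> monomials \<and> ideal_gen G = I \<and> (\<forall>H. H \<subset> G \<longrightarrow> ideal_gen H \<noteq> I)"

text \<open>
  The set \<open>G(I)\<close>. Existence and uniqueness for monomial ideals are proved below in
  \<open>ex1_min_mon_gens\<close>.
\<close>

definition min_mon_gens :: "('n::finite, 'k::field) mpoly set \<Rightarrow> ('n, 'k) mpoly set" where
  "min_mon_gens I = (THE G. is_min_mon_gens I G)"

interpretation ideal: module "(*) :: 'a::comm_ring_1 \<Rightarrow> 'a \<Rightarrow> 'a"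
  by unfold_locales (auto simp: algebra_simps)

lemma keys_in_ideal_gen:
  fixes A :: "('n::finite, 'k::field) mpoly set"
  assumes "A \<subseteq> monomials" "f \<in> ideal_gen A" "e \<in> Poly_Mapping.keys f"
  shows "\<exists>u w. Poly_Mapping.single u 1 \<in> A \<and> e = u + w"
proof -
  define T :: "('n, 'k) mpoly set" where
    "T = {f. \<forall>e\<in>Poly_Mapping.keys f. \<exists>u w. Poly_Mapping.single u 1 \<in> A \<and> e = u + w}"
  have "ideal.subspace T"
  proof (rule ideal.subspaceI)
    show "0 \<in> T" by (simp add: T_def)
    show "x + y \<in> T" if "x \<in> T" "y \<in> T" for x y
      using that Poly_Mapping.keys_add[of x y] unfolding T_def by blast
    show "c * x \<in> T" if x: "x \<in> T" for c x
      unfolding T_def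
    proof (intro CollectI ballI)
      fix e assume "e \<in> Poly_Mapping.keys (c * x)"
      then obtain a b where ab: "e = a + b" "b \<in> Poly_Mapping.keys x"
        using keys_mult[of c x] by blast
      then obtain u w where "Poly_Mapping.single u 1 \<in> A" "b = u + w"
        using x unfolding T_def by blast
      with ab show "\<exists>u w. Poly_Mapping.single u 1 \<in> A \<and> e = u + w"
        by (intro exI[of _ u] exI[of _ "a + w"]) (simp add: ac_simps)
    qed
  qed
  moreover have "A \<subseteq> T"
  proof
    fix x assume x: "x \<in> A"
    then obtain u where "x = Poly_Mapping.single u 1"
      using assms(1) by (auto simp: monomials_def)
    have "\<exists>u w. Poly_Mapping.single u 1 \<in> A \<and> e = u + w" if "e \<in> Poly_Mapping.keys x" for e
    proof -
      from that \<open>x = _\<close> have "e = u + 0" by (simp split: if_splits)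
      with x \<open>x = _\<close> show ?thesis by metis
    qed
    then show "x \<in> T" by (simp add: T_def)
  qed
  ultimately have "ideal_gen A \<subseteq> T" by (intro ideal.span_minimal)
  with assms(2,3) show ?thesis unfolding T_def by blast
qed

theorem ex1_min_mon_gens:
  fixes I :: "('n::finite, 'k::field) mpoly set"
  assumes "monomial_ideal I"
  shows "\<exists>!G. is_min_mon_gens I G"
proof -
  let ?m = "\<lambda>u::'n \<Rightarrow>\<^sub>0 nat. Poly_Mapping.single u (1::'k)"
  obtain A where A: "A \<subseteq> monomials" "ideal_gen A = I"
    using assms by (auto simp: monomial_ideal_def)
  define M where "M = {u. ?m u \<in> I \<and> (\<forall>v w. ?m v \<in> I \<longrightarrow> u = v + w \<longrightarrow> v = u)}"
  define deg where "deg u = (\<Sum>i\<in>UNIV. Poly_Mapping.lookup u i)" for u :: "'n \<Rightarrow>\<^sub>0 nat"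
  have deg_add: "deg (u + v) = deg u + deg v" for u v
    by (simp add: deg_def lookup_add sum.distrib)
  have deg_0: "u = 0" if "deg u = 0" for u
    using that by (intro poly_mapping_eqI) (simp add: deg_def)
  have below: "\<exists>v w. v \<in> M \<and> u = v + w" if "?m u \<in> I" for u
    using that
  proof (induction "deg u" arbitrary: u rule: less_induct)
    case less
    show ?case
    proof (cases "u \<in> M")
      case True
      then show ?thesis by (intro exI[of _ u] exI[of _ 0]) simp
    next
      case False
      then obtain v w where vw: "?m v \<in> I" "u = v + w" "v \<noteq> u"
        using less.prems unfolding M_def by blast
      then have "deg w \<noteq> 0" using deg_0[of w] by auto
      then have "deg v < deg u" using vw by (simp add: deg_add)
      from less.hyps[OF this vw(1)] obtain v' w' where "v' \<in> M" "v = v' + w'" by blast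
      with vw(2) show ?thesis
        by (intro exI[of _ v'] exI[of _ "w' + w"]) (simp add: ac_simps)
    qed
  qed
  have M_I: "?m ` M \<subseteq> I" by (auto simp: M_def)
  have sub_I: "ideal.subspace I" using A(2) ideal.subspace_span by blast
  have gen_M: "ideal_gen (?m ` M) = I"
  proof
    show "ideal_gen (?m ` M) \<subseteq> I" using M_I sub_I by (rule ideal.span_minimal)
    have "A \<subseteq> ideal_gen (?m ` M)"
    proof
      fix x assume x: "x \<in> A"
      then obtain u where u: "x = ?m u" using A(1) by (auto simp: monomials_def)
      have "?m u \<in> I" using x u A(2) ideal.span_base by blast
      from below[OF this] obtain v w where vw: "v \<in> M" "u = v + w" by blast
      then have "x = ?m w * ?m v" using u by (simp add: mult_single ac_simps)
      with vw(1) show "x \<in> ideal_gen (?m ` M)"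
        by (simp add: ideal.span_base ideal.span_scale)
    qed
    then show "I \<subseteq> ideal_gen (?m ` M)"
      using A(2) ideal.span_minimal ideal.subspace_span by blast
  qed
  have incl: "?m ` M \<subseteq> H" if H: "H \<subseteq> monomials" "ideal_gen H = I" for H
  proof
    fix x assume "x \<in> ?m ` M"
    then obtain u where u: "u \<in> M" "x = ?m u" by blast
    then have "?m u \<in> ideal_gen H" using M_I H(2) by blast
    from keys_in_ideal_gen[OF H(1) this, of u] obtain v w where v: "?m v \<in> H" "u = v + w"
      by auto
    then have "?m v \<in> I" using H(2) ideal.span_base by blast
    with u(1) v have "v = u" unfolding M_def by blast
    with u(2) v(1) show "x \<in> H" by simp
  qed
  show ?thesis
  proof (rule ex1I)
    show "is_min_mon_gens I (?m ` M)"
      unfolding is_min_mon_gens_def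
    proof (intro conjI allI impI notI)
      show mon: "?m ` M \<subseteq> monomials" by (auto simp: monomials_def)
      show "ideal_gen (?m ` M) = I" by (rule gen_M)
      fix H assume "H \<subset> ?m ` M" "ideal_gen H = I"
      with incl[of H] mon show False by blast
    qed
    show "G = ?m ` M" if "is_min_mon_gens I G" for G
      using that incl[of G] gen_M unfolding is_min_mon_gens_def by blast
  qed
qed


section \<open>Stanley depth\<close>

text \<open>
  A \<open>\<int>\<^sup>n\<close>-graded module is given by its scalar multiplication \<open>scale\<close>, its carrier \<open>M\<close> and
  its homogeneous components \<open>gr a \<subseteq> M\<close>.
\<close>

definition stanley_space ::
    "(('n::finite, 'k::field) mpoly \<Rightarrow> 'm::ab_group_add \<Rightarrow> 'm) \<Rightarrow> 'm \<Rightarrow> 'n set \<Rightarrow> 'm set" where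
  "stanley_space scale m Z = (\<lambda>f. scale f m) ` polys_in Z"

text \<open>The space \<open>m K[Z]\<close> is free over \<open>K[Z]\<close> with basis \<open>m\<close>; in particular \<open>m \<noteq> 0\<close>.\<close>

definition free_stanley_space ::
    "(('n::finite, 'k::field) mpoly \<Rightarrow> 'm::ab_group_add \<Rightarrow> 'm) \<Rightarrow> 'm \<Rightarrow> 'n set \<Rightarrow> bool" where
  "free_stanley_space scale m Z \<longleftrightarrow> inj_on (\<lambda>f. scale f m) (polys_in Z)"

text \<open>
  \<open>M\<close> is the internal direct sum of the finite family of subspaces \<open>V i\<close>: every element of \<open>M\<close> is
  the sum of a unique family of elements of the \<open>V i\<close>, and all such sums lie in \<open>M\<close>.
\<close>

definition direct_sum_of :: "'m::ab_group_add set \<Rightarrow> 'i set \<Rightarrow> ('i \<Rightarrow> 'm set) \<Rightarrow> bool" where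
  "direct_sum_of M A V \<longleftrightarrow> bij_betw (\<lambda>v. \<Sum>i\<in>A. v i) (PiE A V) M"

definition stanley_decomposition ::
    "(('n::finite, 'k::field) mpoly \<Rightarrow> 'm::ab_group_add \<Rightarrow> 'm) \<Rightarrow> 'm set \<Rightarrow> (('n \<Rightarrow> int) \<Rightarrow> 'm set)
      \<Rightarrow> ('m \<times> 'n set) list \<Rightarrow> bool" where
  "stanley_decomposition scale M gr D \<longleftrightarrow>
     (\<forall>(m, Z)\<in>set D. m \<in> M \<and> (\<exists>a. m \<in> gr a) \<and> free_stanley_space scale m Z) \<and>
     direct_sum_of M {..<length D} (\<lambda>i. stanley_space scale (fst (D ! i)) (snd (D ! i)))"

definition decomp_sdepth :: "('m \<times> 'n::finite set) list \<Rightarrow> nat" where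
  "decomp_sdepth D = Min ((\<lambda>(m, Z). card Z) ` set D)"

text \<open>
  Meaningful for \<open>M \<noteq> {0}\<close> finitely generated: then Stanley decompositions exist, none of them is
  empty, and their depths are bounded by \<open>CARD('n)\<close>.
\<close>

definition sdepth ::
    "(('n::finite, 'k::field) mpoly \<Rightarrow> 'm::ab_group_add \<Rightarrow> 'm) \<Rightarrow> 'm set \<Rightarrow> (('n \<Rightarrow> int) \<Rightarrow> 'm set)
      \<Rightarrow> nat" where
  "sdepth scale M gr = Max {decomp_sdepth D |D. stanley_decomposition scale M gr D}"

text \<open>A monomial ideal is a graded submodule of the polynomial ring.\<close>

definition ideal_sdepth :: "('n::finite, 'k::field) mpoly set \<Rightarrow> nat" where
  "ideal_sdepth I = sdepth (*) I (\<lambda>a. I \<inter> hom_comp a)"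

end

theory Submission
  imports Defs "HOL-Library.Disjoint_Sets"
begin

text \<open>
  Let \<open>U\<^sub>i\<close> be the set of exponents of the multiples of the \<open>i\<close>-th generator. The exponents of the
  monomials in the ideal form \<open>U\<^sub>1 \<union> U\<^sub>2 \<union> U\<^sub>3\<close>, which is the disjoint union of \<open>U\<^sub>1 - U\<^sub>3\<close>, \<open>U\<^sub>2 - U\<^sub>1\<close>,
  \<open>U\<^sub>3 - U\<^sub>2\<close> and \<open>U\<^sub>1 \<inter> U\<^sub>2 \<inter> U\<^sub>3\<close>. The last set consists of the multiples of the least common multiple,
  and each of the differences splits into translates of coordinate hyperplanes. Conversely, two
  Stanley spaces \<open>m S\<close> and \<open>m' S\<close> both contain \<open>m m'\<close>, so an ideal of Stanley depth \<open>n\<close> is principal.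
\<close>

section \<open>Partitions of sets of exponents\<close>

text \<open>Divisibility of monomials, read off their exponents.\<close>

definition exp_le :: "('n \<Rightarrow>\<^sub>0 nat) \<Rightarrow> ('n \<Rightarrow>\<^sub>0 nat) \<Rightarrow> bool" (infix "\<preceq>" 50) where
  "u \<preceq> e \<longleftrightarrow> (\<forall>i. Poly_Mapping.lookup u i \<le> Poly_Mapping.lookup e i)"

lemma exp_le_refl [simp]: "u \<preceq> u"
  by (simp add: exp_le_def)

lemma exp_le_trans: "u \<preceq> v \<Longrightarrow> v \<preceq> w \<Longrightarrow> u \<preceq> w"
  unfolding exp_le_def by (meson le_trans)

lemma exp_le_add [simp]: "u \<preceq> u + w"
  by (simp add: exp_le_def lookup_add)

text \<open>Subtraction of exponents is truncated in each coordinate; divisibility makes it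
  exact.\<close>

lemma exp_le_add_diff: "u \<preceq> e \<Longrightarrow> u + (e - u) = e"
  by (intro poly_mapping_eqI) (simp add: exp_le_def lookup_add lookup_minus)

text \<open>The exponents of the monomials in the Stanley space \<open>x\<^sup>w K[Z]\<close>.\<close>

fun box :: "('n \<Rightarrow>\<^sub>0 nat) \<times> 'n set \<Rightarrow> ('n \<Rightarrow>\<^sub>0 nat) set" where
  "box (w, Z) =
    {e. w \<preceq> e \<and> (\<forall>i. i \<notin> Z \<longrightarrow> Poly_Mapping.lookup e i = Poly_Mapping.lookup w i)}"

text \<open>The coordinatewise form suits membership tests; the form as a translate is what
  multiplying \<open>K[Z]\<close> by a monomial produces.\<close>

lemma box_eq: "box (w, Z) = {w + d |d. Poly_Mapping.keys d \<subseteq> Z}"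
proof (intro set_eqI iffI)
  fix e assume e: "e \<in> box (w, Z)"
  then have "e = w + (e - w)"
    by (simp add: exp_le_add_diff)
  moreover from e have "Poly_Mapping.keys (e - w) \<subseteq> Z"
    by (auto simp: in_keys_iff lookup_minus)
  ultimately show "e \<in> {w + d |d. Poly_Mapping.keys d \<subseteq> Z}"
    by blast
next
  fix e assume "e \<in> {w + d |d. Poly_Mapping.keys d \<subseteq> Z}"
  then show "e \<in> box (w, Z)"
    by (auto simp: lookup_add in_keys_iff)
qed

text \<open>The combinatorial counterpart of a Stanley decomposition of depth at least
  \<open>k\<close>: the pair \<open>(w, Z)\<close> stands for the space generated over
  \<open>K[Z]\<close> by the monomial with exponent \<open>w\<close>.\<close>

definition box_partition :: "nat \<Rightarrow> ('n \<Rightarrow>\<^sub>0 nat) set \<Rightarrow> (('n \<Rightarrow>\<^sub>0 nat) \<times> 'n set) set \<Rightarrow> bool" where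
  "box_partition k X P \<longleftrightarrow>
    finite P \<and> disjoint_family_on box P \<and> (\<Union>p\<in>P. box p) = X \<and> (\<forall>p\<in>P. k \<le> card (snd p))"

lemma box_partition_box: "k \<le> card Z \<Longrightarrow> box_partition k (box (w, Z)) {(w, Z)}"
  by (simp add: box_partition_def disjoint_family_on_def)

lemma box_partition_Un:
  assumes "box_partition k X P" "box_partition k Y Q" "X \<inter> Y = {}"
  shows "box_partition k (X \<union> Y) (P \<union> Q)"
proof -
  have "box p \<inter> box q = {}" if "p \<in> P" "q \<in> Q" for p q
    using that assms unfolding box_partition_def by blast
  moreover have "disjoint_family_on box P" "disjoint_family_on box Q"
    using assms by (simp_all add: box_partition_def)
  ultimately have "disjoint_family_on box (P \<union> Q)"
    unfolding disjoint_family_on_def by (metis Un_iff Int_commute)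
  then show ?thesis
    using assms unfolding box_partition_def by (simp add: UN_Un ball_Un)
qed

lemma ex_box_partition_UN:
  assumes "finite J" "disjoint_family_on X J" "\<And>j. j \<in> J \<Longrightarrow> \<exists>P. box_partition k (X j) P"
  shows "\<exists>P. box_partition k (\<Union>j\<in>J. X j) P"
  using assms
proof (induction J rule: finite_induct)
  case empty
  show ?case
    by (intro exI[of _ "{}"]) (simp add: box_partition_def disjoint_family_on_def)
next
  case (insert j J)
  have "disjoint_family_on X J"
    using insert.prems(1) by (auto intro: disjoint_family_on_mono)
  then obtain P Q where PQ: "box_partition k (\<Union>j\<in>J. X j) P" "box_partition k (X j) Q"
    using insert by blast
  have "X j \<inter> (\<Union>j\<in>J. X j) = {}"
    using insert.prems(1) insert.hyps(2) by (auto simp: disjoint_family_on_def)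
  from box_partition_Un[OF PQ(2,1) this] show ?case
    by auto
qed

text \<open>
  Induction on \<open>T\<close>: the exponents added by \<open>i\<close> are those with \<open>e i = j < v i\<close> that lie above
  \<open>v\<close> on \<open>T\<close>; for fixed \<open>j\<close> they form a box in which only the coordinate \<open>i\<close> is fixed.
\<close>

lemma ex_box_partition_not_above_on:
  fixes u v :: "'n::finite \<Rightarrow>\<^sub>0 nat"
  shows "\<exists>P. box_partition (CARD('n) - 1)
    {e. u \<preceq> e \<and> (\<exists>i\<in>T. Poly_Mapping.lookup e i < Poly_Mapping.lookup v i)} P"
proof (induction T rule: finite_induct[OF finite])
  case 1
  show ?case
    by (intro exI[of _ "{}"]) (simp add: box_partition_def disjoint_family_on_def)
next
  case (2 i T)
  let ?l = Poly_Mapping.lookup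
  \<comment> \<open>The least exponent of the slice on which coordinate \<open>i\<close> equals
    \<open>j\<close>: on \<open>T\<close> it must dominate both \<open>u\<close> and
    \<open>v\<close>, elsewhere only \<open>u\<close>.\<close>
  define w where "w j = Abs_poly_mapping
    (\<lambda>t. if t = i then j else if t \<in> T then max (?l u t) (?l v t) else ?l u t)" for j
  \<comment> \<open>Starting at \<open>?l u i\<close> ensures \<open>u \<preceq> e\<close> at
    coordinate \<open>i\<close>; the range is empty if \<open>v\<close> does not exceed
    \<open>u\<close> there.\<close>
  define J where "J = {?l u i..<?l v i}"
  have lw: "?l (w j) t =
      (if t = i then j else if t \<in> T then max (?l u t) (?l v t) else ?l u t)" for j t
    by (simp add: w_def)
  have in_box: "e \<in> box (w j, - {i}) \<longleftrightarrow>
      ?l e i = j \<and> (\<forall>t. t \<noteq> i \<longrightarrow> ?l u t \<le> ?l e t) \<and> (\<forall>t\<in>T. ?l v t \<le> ?l e t)" for e j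
    using \<open>i \<notin> T\<close> by (auto simp: exp_le_def lw split: if_splits)
  have "\<exists>P. box_partition (CARD('n) - 1) (\<Union>j\<in>J. box (w j, - {i})) P"
  proof (rule ex_box_partition_UN)
    show "disjoint_family_on (\<lambda>j. box (w j, - {i})) J"
      by (auto simp: disjoint_family_on_def in_box simp del: box.simps)
    have "CARD('n) - 1 \<le> card (- {i})"
      by (simp add: Compl_eq_Diff_UNIV card_Diff_singleton)
    then show "\<exists>P. box_partition (CARD('n) - 1) (box (w j, - {i})) P" for j
      using box_partition_box by blast
  qed (simp add: J_def)
  moreover have "(\<Union>j\<in>J. box (w j, - {i})) =
      {e. u \<preceq> e \<and> ?l e i < ?l v i \<and> (\<forall>t\<in>T. ?l v t \<le> ?l e t)}"
    by (auto simp: in_box J_def exp_le_def simp del: box.simps)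
  ultimately obtain P where P: "box_partition (CARD('n) - 1)
      {e. u \<preceq> e \<and> ?l e i < ?l v i \<and> (\<forall>t\<in>T. ?l v t \<le> ?l e t)} P"
    by metis
  obtain Q where "box_partition (CARD('n) - 1) {e. u \<preceq> e \<and> (\<exists>i\<in>T. ?l e i < ?l v i)} Q"
    using 2 by blast
  from box_partition_Un[OF P this] have "box_partition (CARD('n) - 1) ({e. u \<preceq> e \<and> ?l e i < ?l v i \<and> (\<forall>t\<in>T. ?l v t \<le> ?l e t)} \<union>
      {e. u \<preceq> e \<and> (\<exists>i\<in>T. ?l e i < ?l v i)}) (P \<union> Q)"
    by fastforce
  moreover have "{e. u \<preceq> e \<and> ?l e i < ?l v i \<and> (\<forall>t\<in>T. ?l v t \<le> ?l e t)} \<union>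
      {e. u \<preceq> e \<and> (\<exists>i\<in>T. ?l e i < ?l v i)} = {e. u \<preceq> e \<and> (\<exists>t\<in>insert i T. ?l e t < ?l v t)}"
    by (auto simp: not_less)
  ultimately show ?case
    by metis
qed

text \<open>Failing to lie above \<open>v\<close> means dropping below \<open>v\<close> in some
  coordinate, so this is the preceding lemma with \<open>T = UNIV\<close>.\<close>

lemma ex_box_partition_diff:
  fixes u v :: "'n::finite \<Rightarrow>\<^sub>0 nat"
  shows "\<exists>P. box_partition (CARD('n) - 1) ({e. u \<preceq> e} - {e. v \<preceq> e}) P"
proof -
  have "{e. u \<preceq> e} - {e. v \<preceq> e} =
      {e. u \<preceq> e \<and> (\<exists>i\<in>UNIV. Poly_Mapping.lookup e i < Poly_Mapping.lookup v i)}"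
    by (auto simp: exp_le_def not_le) (meson leD)
  then show ?thesis
    using ex_box_partition_not_above_on[of u UNIV v] by simp
qed

text \<open>Any two of the three cyclic differences are neighbours in the cycle: one requires
  membership in a set that the other excludes, so they are disjoint. A point of the union outside
  all three differences lies in every set.\<close>

lemma ex_box_partition_above_three:
  fixes u v w :: "'n::finite \<Rightarrow>\<^sub>0 nat"
  shows "\<exists>P. box_partition (CARD('n) - 1) {e. u \<preceq> e \<or> v \<preceq> e \<or> w \<preceq> e} P"
proof -
  let ?U = "\<lambda>u::'n \<Rightarrow>\<^sub>0 nat. {e. u \<preceq> e}" and ?l = Poly_Mapping.lookup
  let ?lcm = "Abs_poly_mapping (\<lambda>i. max (?l u i) (max (?l v i) (?l w i)))"
  have "?U u \<inter> ?U v \<inter> ?U w = box (?lcm, UNIV)"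
    by (auto simp: exp_le_def)
  moreover have "\<exists>P. box_partition (CARD('n) - 1) (box (?lcm, UNIV)) P"
    using box_partition_box[of "CARD('n) - 1" UNIV] by force
  ultimately obtain P where P: "box_partition (CARD('n) - 1) (?U u \<inter> ?U v \<inter> ?U w) P"
    by metis
  obtain Q1 Q2 Q3 where Q: "box_partition (CARD('n) - 1) (?U u - ?U w) Q1"
      "box_partition (CARD('n) - 1) (?U v - ?U u) Q2"
      "box_partition (CARD('n) - 1) (?U w - ?U v) Q3"
    using ex_box_partition_diff by metis
  have "box_partition (CARD('n) - 1)
      ((((?U u - ?U w) \<union> (?U v - ?U u)) \<union> (?U w - ?U v)) \<union> (?U u \<inter> ?U v \<inter> ?U w))
      (((Q1 \<union> Q2) \<union> Q3) \<union> P)"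
    by (intro box_partition_Un P Q) auto
  moreover have "(((?U u - ?U w) \<union> (?U v - ?U u)) \<union> (?U w - ?U v)) \<union> (?U u \<inter> ?U v \<inter> ?U w) =
      {e. u \<preceq> e \<or> v \<preceq> e \<or> w \<preceq> e}"
    by auto
  ultimately show ?thesis
    by metis
qed

section \<open>Stanley spaces and Stanley decompositions\<close>

lemma poly_mapping_sum_singles:
  "(\<Sum>e\<in>Poly_Mapping.keys f. Poly_Mapping.single e (Poly_Mapping.lookup f e)) = f"
  by (rule poly_mapping_eqI)
    (auto simp: lookup_sum lookup_single when_def in_keys_iff sum.delta')

text \<open>By cancellation in the exponents, a single term of the convolution survives.\<close>

lemma lookup_single_mult_add:
  fixes w :: "'a::cancel_comm_monoid_add" and c :: "'b::comm_semiring_1"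
  shows "Poly_Mapping.lookup (Poly_Mapping.single w c * f) (w + u) = c * Poly_Mapping.lookup f u"
  by (simp add: lookup_mult lookup_single when_mult)

lemma keys_single_mult:
  fixes c :: "'b::comm_semiring_1"
  shows "Poly_Mapping.keys (Poly_Mapping.single w c * f) \<subseteq> (+) w ` Poly_Mapping.keys f"
  using keys_mult[of "Poly_Mapping.single w c" f] by (auto split: if_splits)

lemma free_stanley_space_single:
  "free_stanley_space (*) (Poly_Mapping.single w 1 :: ('n::finite, 'k::field) mpoly) Z"
  unfolding free_stanley_space_def
proof (rule inj_onI)
  fix f g :: "('n, 'k) mpoly"
  assume "f * Poly_Mapping.single w 1 = g * Poly_Mapping.single w 1"
  then have "Poly_Mapping.lookup (Poly_Mapping.single w 1 * f) (w + u) =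
      Poly_Mapping.lookup (Poly_Mapping.single w 1 * g) (w + u)" for u
    by (simp add: mult.commute)
  then show "f = g"
    by (intro poly_mapping_eqI) (simp add: lookup_single_mult_add)
qed

text \<open>Multiplication by a monomial shifts supports, so these spaces are determined by
  exponents alone and direct sums of them reduce to disjoint boxes.\<close>

lemma stanley_space_single:
  "stanley_space (*) (Poly_Mapping.single w 1 :: ('n::finite, 'k::field) mpoly) Z =
    {f. Poly_Mapping.keys f \<subseteq> box (w, Z)}"
proof (intro set_eqI iffI)
  fix f :: "('n, 'k) mpoly"
  assume "f \<in> stanley_space (*) (Poly_Mapping.single w 1) Z"
  then obtain g :: "('n, 'k) mpoly"
    where g: "g \<in> polys_in Z" "f = Poly_Mapping.single w 1 * g"
    by (auto simp: stanley_space_def mult.commute)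
  then show "f \<in> {f. Poly_Mapping.keys f \<subseteq> box (w, Z)}"
    using keys_single_mult[of w 1 g] unfolding box_eq polys_in_def by blast
next
  fix f :: "('n, 'k) mpoly"
  assume f: "f \<in> {f. Poly_Mapping.keys f \<subseteq> box (w, Z)}"
  \<comment> \<open>The quotient of \<open>f\<close> by the monomial: its coefficient at
    \<open>d\<close> is that of \<open>f\<close> at \<open>w + d\<close>.\<close>
  define g where "g = Poly_Mapping.map_key ((+) w) f"
  have lookup_g: "Poly_Mapping.lookup g d = Poly_Mapping.lookup f (w + d)" for d
    by (simp add: g_def map_key.rep_eq)
  have "g \<in> polys_in Z"
    unfolding polys_in_def
  proof (intro CollectI ballI)
    fix d assume "d \<in> Poly_Mapping.keys g"
    then have "w + d \<in> box (w, Z)"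
      using f by (auto simp: in_keys_iff lookup_g simp del: box.simps)
    then show "Poly_Mapping.keys d \<subseteq> Z"
      unfolding box_eq by auto
  qed
  moreover have "f = g * Poly_Mapping.single w 1"
  proof (rule poly_mapping_eqI)
    fix e
    show "Poly_Mapping.lookup f e = Poly_Mapping.lookup (g * Poly_Mapping.single w 1) e"
    proof (cases "w \<preceq> e")
      case True
      then have "e = w + (e - w)"
        by (simp add: exp_le_add_diff)
      then show ?thesis
        by (metis lookup_single_mult_add lookup_g mult.commute mult_1)
    next
      case False
      then have "e \<notin> Poly_Mapping.keys f" "e \<notin> Poly_Mapping.keys (Poly_Mapping.single w 1 * g)"
        using f keys_single_mult[of w 1 g] by auto
      then show ?thesis
        by (simp add: in_keys_iff mult.commute)
    qed
  qed
  ultimately show "f \<in> stanley_space (*) (Poly_Mapping.single w 1) Z"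
    by (auto simp: stanley_space_def)
qed

text \<open>Each exponent of the union belongs to exactly one \<open>B i\<close>, so the summands
  are recovered from the sum by restricting its support.\<close>

lemma direct_sum_of_keys_subset:
  fixes B :: "'i \<Rightarrow> 'a set"
  assumes "finite A" "disjoint_family_on B A"
  shows "direct_sum_of {f :: 'a \<Rightarrow>\<^sub>0 'b::ab_group_add. Poly_Mapping.keys f \<subseteq> (\<Union>i\<in>A. B i)} A
    (\<lambda>i. {f. Poly_Mapping.keys f \<subseteq> B i})"
proof -
  let ?l = "Poly_Mapping.lookup :: ('a \<Rightarrow>\<^sub>0 'b) \<Rightarrow> _"
  let ?V = "\<lambda>i. {f :: 'a \<Rightarrow>\<^sub>0 'b. Poly_Mapping.keys f \<subseteq> B i}"
  \<comment> \<open>On \<open>B j\<close> all other summands vanish.\<close>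
  have lookup_sum_V: "?l (\<Sum>i\<in>A. v i) e = ?l (v j) e"
    if "v \<in> PiE A ?V" "j \<in> A" "e \<in> B j" for v j e
  proof -
    have "?l (v i) e = 0" if "i \<in> A" "i \<noteq> j" for i
    proof -
      have "e \<notin> B i"
        using assms(2) that \<open>j \<in> A\<close> \<open>e \<in> B j\<close> by (auto simp: disjoint_family_on_def)
      then show ?thesis
        using PiE_mem[OF \<open>v \<in> PiE A ?V\<close> \<open>i \<in> A\<close>] by (auto simp: in_keys_iff)
    qed
    then show ?thesis
      using \<open>j \<in> A\<close> assms(1) by (simp add: sum.remove[of A j] lookup_add lookup_sum)
  qed
  have "inj_on (\<lambda>v. \<Sum>i\<in>A. v i) (PiE A ?V)"
  proof (rule inj_onI)
    fix v v' assume v: "v \<in> PiE A ?V" "v' \<in> PiE A ?V" and eq: "(\<Sum>i\<in>A. v i) = (\<Sum>i\<in>A. v' i)"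
    show "v = v'"
    proof (rule PiE_ext[OF v])
      fix i assume "i \<in> A"
      show "v i = v' i"
      proof (rule poly_mapping_eqI)
        fix e
        show "?l (v i) e = ?l (v' i) e"
        proof (cases "e \<in> B i")
          case True
          then show ?thesis
            using lookup_sum_V[OF v(1) \<open>i \<in> A\<close>] lookup_sum_V[OF v(2) \<open>i \<in> A\<close>] eq by metis
        next
          case False
          then have "e \<notin> Poly_Mapping.keys (v i)" "e \<notin> Poly_Mapping.keys (v' i)"
            using PiE_mem[OF v(1) \<open>i \<in> A\<close>] PiE_mem[OF v(2) \<open>i \<in> A\<close>] by auto
          then show ?thesis
            by (simp add: in_keys_iff)
        qed
      qed
    qed
  qed
  moreover have "(\<lambda>v. \<Sum>i\<in>A. v i) ` PiE A ?V =
      {f. Poly_Mapping.keys f \<subseteq> (\<Union>i\<in>A. B i)}"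
  proof (intro set_eqI iffI)
    fix f assume "f \<in> (\<lambda>v. \<Sum>i\<in>A. v i) ` PiE A ?V"
    then obtain v where v: "v \<in> PiE A ?V" "f = (\<Sum>i\<in>A. v i)"
      by blast
    have "e \<in> (\<Union>i\<in>A. B i)" if "e \<in> Poly_Mapping.keys f" for e
    proof -
      from that have "(\<Sum>i\<in>A. ?l (v i) e) \<noteq> 0"
        by (simp add: in_keys_iff v(2) lookup_sum)
      then obtain i where "i \<in> A" "?l (v i) e \<noteq> 0"
        by (meson sum.neutral)
      then show ?thesis
        using PiE_mem[OF v(1), of i] by (auto simp: in_keys_iff)
    qed
    then show "f \<in> {f. Poly_Mapping.keys f \<subseteq> (\<Union>i\<in>A. B i)}"
      by blast
  next
    fix f :: "'a \<Rightarrow>\<^sub>0 'b" assume f: "f \<in> {f. Poly_Mapping.keys f \<subseteq> (\<Union>i\<in>A. B i)}"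
    \<comment> \<open>The part of \<open>f\<close> supported in \<open>B i\<close>; restricting the
      function to \<open>A\<close> makes it extensional, as \<open>PiE\<close> demands.\<close>
    define v where
      "v = (\<lambda>i\<in>A. Poly_Mapping.mapp (\<lambda>e x. if e \<in> B i then x else 0) f)"
    have lookup_v: "?l (v i) e = (if e \<in> B i then ?l f e else 0)" if "i \<in> A" for i e
      using that by (auto simp: v_def lookup_mapp when_def in_keys_iff)
    have v: "v \<in> PiE A ?V"
    proof (rule PiE_I)
      fix i assume "i \<in> A"
      then show "v i \<in> ?V i"
        using lookup_v[of i] by (auto simp: in_keys_iff split: if_splits)
    qed (simp add: v_def)
    have "f = (\<Sum>i\<in>A. v i)"
    proof (rule poly_mapping_eqI)
      fix e
      show "?l f e = ?l (\<Sum>i\<in>A. v i) e"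
      proof (cases "\<exists>i\<in>A. e \<in> B i")
        case True
        then show ?thesis
          using lookup_sum_V[OF v] lookup_v by fastforce
      next
        case False
        moreover from this have "?l f e = 0"
          using f by (auto simp: in_keys_iff)
        ultimately show ?thesis
          by (simp add: lookup_sum lookup_v)
      qed
    qed
    then show "f \<in> (\<lambda>v. \<Sum>i\<in>A. v i) ` PiE A ?V"
      using v by blast
  qed
  ultimately show ?thesis
    by (simp add: direct_sum_of_def bij_betw_def)
qed

text \<open>Each box becomes the Stanley space of a monomial, and disjoint boxes give independent
  summands. This yields the lower bound for the depth.\<close>

lemma stanley_decomposition_of_box_partition:
  fixes I :: "('n::finite, 'k::field) mpoly set"
  assumes I: "I = {f. Poly_Mapping.keys f \<subseteq> X}" and P: "box_partition k X P"
  shows "\<exists>D. stanley_decomposition (*) I (\<lambda>a. I \<inter> hom_comp a) D \<and> (\<forall>(m, Z)\<in>set D. k \<le> card Z)"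
proof -
  \<comment> \<open>A repeated pair would repeat a summand and destroy directness, hence
    \<open>distinct\<close>.\<close>
  obtain L where L: "set L = P" "distinct L"
    using P finite_distinct_list unfolding box_partition_def by blast
  define D where "D = map (\<lambda>(w, Z). (Poly_Mapping.single w (1::'k), Z)) L"
  have "disjoint_family_on (\<lambda>i. box (L ! i)) {..<length L}"
    unfolding disjoint_family_on_def
  proof (intro ballI impI)
    fix i j assume "i \<in> {..<length L}" "j \<in> {..<length L}" "i \<noteq> j"
    then have "L ! i \<in> P" "L ! j \<in> P" "L ! i \<noteq> L ! j"
      using L by (auto simp: nth_eq_iff_index_eq)
    then show "box (L ! i) \<inter> box (L ! j) = {}"
      using P unfolding box_partition_def disjoint_family_on_def by blast
  qed
  moreover have "(\<Union>i<length L. box (L ! i)) = X"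
    using P L unfolding box_partition_def by (force simp: set_conv_nth simp del: box.simps)
  moreover have "stanley_space (*) (fst (D ! i)) (snd (D ! i)) =
      {f. Poly_Mapping.keys f \<subseteq> box (L ! i)}" if "i \<in> {..<length L}" for i
    using that stanley_space_single[of "fst (L ! i)" "snd (L ! i)", where 'k = 'k]
    by (simp add: D_def case_prod_beta del: box.simps)
  \<comment> \<open>\<open>direct_sum_of\<close> sees the family only through its
    \<open>PiE\<close>, so agreement on valid indices suffices.\<close>
  then have "PiE {..<length L} (\<lambda>i. stanley_space (*) (fst (D ! i)) (snd (D ! i))) =
      PiE {..<length L} (\<lambda>i. {f. Poly_Mapping.keys f \<subseteq> box (L ! i)})"
    by (rule PiE_cong)
  moreover have "length D = length L"
    by (simp add: D_def)
  ultimately have "direct_sum_of I {..<length D}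
      (\<lambda>i. stanley_space (*) (fst (D ! i)) (snd (D ! i)))"
    using direct_sum_of_keys_subset[of "{..<length L}" "\<lambda>i. box (L ! i)", where 'b = 'k] I
    by (simp add: direct_sum_of_def del: box.simps)
  moreover have "m \<in> I \<and> (\<exists>a. m \<in> I \<inter> hom_comp a) \<and> free_stanley_space (*) m Z \<and> k \<le> card Z"
    if "(m, Z) \<in> set D" for m Z
  proof -
    from that obtain w where w: "(w, Z) \<in> P" "m = Poly_Mapping.single w 1"
      using L by (auto simp: D_def)
    then have "w \<in> X"
      using P unfolding box_partition_def by force
    then have "m \<in> I"
      using I w by simp
    moreover have "m \<in> hom_comp (\<lambda>i. int (Poly_Mapping.lookup w i))"
      by (simp add: hom_comp_def w)
    ultimately show ?thesis
      using w P free_stanley_space_single[of w Z] unfolding box_partition_def by fastforce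
  qed
  ultimately show ?thesis
    unfolding stanley_decomposition_def by (intro exI[of _ D]) auto
qed

section \<open>Decompositions in which every variable is free\<close>

lemma free_stanley_space_nonzero:
  fixes m :: "('n::finite, 'k::field) mpoly"
  assumes "free_stanley_space (*) m Z"
  shows "m \<noteq> 0"
proof
  assume "m = 0"
  moreover have "(0 :: ('n, 'k) mpoly) \<in> polys_in Z" "(1 :: ('n, 'k) mpoly) \<in> polys_in Z"
    by (simp_all add: polys_in_def)
  ultimately show False
    using assms unfolding free_stanley_space_def inj_on_def by fastforce
qed

text \<open>The product of two generators lies in both of their summands. Uniqueness of the
  expression as a sum forces it to be 0, which freeness forbids.\<close>

lemma stanley_decomposition_full:
  fixes I :: "('n::finite, 'k::field) mpoly set"
  assumes D: "stanley_decomposition (*) I gr D" and full: "\<forall>(m, Z)\<in>set D. Z = UNIV"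
  shows "length D \<le> 1"
proof (rule ccontr)
  assume "\<not> length D \<le> 1"
  then have len: "0 < length D" "1 < length D"
    by auto
  let ?m = "\<lambda>i. fst (D ! i)"
  have polys_UNIV: "polys_in UNIV = (UNIV :: ('n, 'k) mpoly set)"
    by (simp add: polys_in_def)
  have snd_D: "snd (D ! i) = UNIV" if "i < length D" for i
    using full nth_mem[OF that] by (auto simp: case_prod_beta)
  have free: "free_stanley_space (*) (?m i) (snd (D ! i))" if "i < length D" for i
    using D nth_mem[OF that] unfolding stanley_decomposition_def by (auto simp: case_prod_beta)
  define V where "V i = stanley_space (*) (?m i) (snd (D ! i))" for i
  have mult_V: "f * ?m i \<in> V i" if "i < length D" for f i
    using that by (simp add: V_def stanley_space_def snd_D polys_UNIV)
  have zero_V: "0 \<in> V i" if "i < length D" for i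
    using mult_V[OF that, of 0] by simp
  \<comment> \<open>Two families with the same sum: the product sits in slot \<open>j\<close>, for
    \<open>j = 0\<close> and \<open>j = 1\<close>, and all other slots are 0.\<close>
  define v where "v j = (\<lambda>i\<in>{..<length D}. if i = j then ?m 0 * ?m 1 else 0)" for j
  have "?m 0 * ?m 1 \<in> V 0" "?m 0 * ?m 1 \<in> V 1"
    using mult_V[OF len(1), of "?m 1"] mult_V[OF len(2), of "?m 0"] by (simp_all add: mult.commute)
  then have v_V: "v 0 \<in> PiE {..<length D} V" "v 1 \<in> PiE {..<length D} V"
    by (auto simp: v_def zero_V)
  have sum_v: "(\<Sum>i<length D. v j i) = ?m 0 * ?m 1" if "j < length D" for j
    using that by (simp add: v_def sum.delta)
  have "inj_on (\<lambda>v. \<Sum>i<length D. v i) (PiE {..<length D} V)"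
    using D unfolding stanley_decomposition_def direct_sum_of_def bij_betw_def V_def by blast
  then have "v 0 = v 1"
    by (rule inj_onD[OF _ _ v_V]) (simp only: sum_v len)
  then have "v 0 0 = v 1 0"
    by simp
  \<comment> \<open>Zero is written as a multiple of \<open>?m 1\<close> so that freeness of the
    second summand cancels \<open>?m 1\<close>.\<close>
  then have "?m 0 * ?m 1 = 0 * ?m 1"
    using len by (simp add: v_def)
  moreover have "inj_on (\<lambda>f. f * ?m 1) (UNIV :: ('n, 'k) mpoly set)"
    using free[OF len(2)] unfolding free_stanley_space_def snd_D[OF len(2)] polys_UNIV .
  ultimately have "?m 0 = 0"
    by (metis injD)
  then show False
    using free[OF len(1)] free_stanley_space_nonzero by blast
qed

text \<open>Every term of such a polynomial is itself a multiple of a generator, so membership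
  depends on the support only.\<close>

lemma ideal_gen_singles:
  fixes E :: "('n::finite \<Rightarrow>\<^sub>0 nat) set"
  defines "G \<equiv> (\<lambda>u. Poly_Mapping.single u (1::'k::field)) ` E"
  shows "ideal_gen G = {f. Poly_Mapping.keys f \<subseteq> {e. \<exists>u\<in>E. u \<preceq> e}}"
proof (intro set_eqI iffI)
  fix f assume f: "f \<in> ideal_gen G"
  have "G \<subseteq> monomials"
    by (auto simp: G_def monomials_def)
  show "f \<in> {f. Poly_Mapping.keys f \<subseteq> {e. \<exists>u\<in>E. u \<preceq> e}}"
  proof (intro CollectI subsetI)
    fix e assume "e \<in> Poly_Mapping.keys f"
    from keys_in_ideal_gen[OF \<open>G \<subseteq> monomials\<close> f this]
    obtain u u' w where "u' \<in> E" "Poly_Mapping.single u (1::'k) = Poly_Mapping.single u' 1" "e = u + w"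
      by (auto simp: G_def)
    moreover from this have "u = u'"
      by (metis keys_single singleton_inject one_neq_zero)
    ultimately show "\<exists>u\<in>E. u \<preceq> e"
      by (metis exp_le_add)
  qed
next
  fix f :: "('n, 'k) mpoly" assume f: "f \<in> {f. Poly_Mapping.keys f \<subseteq> {e. \<exists>u\<in>E. u \<preceq> e}}"
  have "Poly_Mapping.single e (Poly_Mapping.lookup f e) \<in> ideal_gen G"
    if "e \<in> Poly_Mapping.keys f" for e
  proof -
    from f that obtain u where u: "u \<in> E" "u \<preceq> e"
      by blast
    then have "Poly_Mapping.single e (Poly_Mapping.lookup f e) =
        Poly_Mapping.single (e - u) (Poly_Mapping.lookup f e) * Poly_Mapping.single u 1"
      by (simp add: mult_single exp_le_add_diff add.commute[of _ u])
    moreover have "Poly_Mapping.single u 1 \<in> ideal_gen G"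
      using u by (simp add: G_def ideal.span_base)
    ultimately show ?thesis
      by (metis ideal.span_scale)
  qed
  then have "(\<Sum>e\<in>Poly_Mapping.keys f. Poly_Mapping.single e (Poly_Mapping.lookup f e)) \<in> ideal_gen G"
    by (rule ideal.span_sum)
  then show "f \<in> ideal_gen G"
    by (simp only: poly_mapping_sum_singles)
qed

text \<open>The decomposition has a single summand \<open>m S\<close>. Being homogeneous and
  nonzero, \<open>m\<close> is a scalar times a monomial, and that monomial divides every monomial
  of \<open>I\<close>.\<close>

lemma stanley_decomposition_full_least_exponent:
  fixes X :: "('n::finite \<Rightarrow>\<^sub>0 nat) set"
  defines "I \<equiv> {f :: ('n, 'k::field) mpoly. Poly_Mapping.keys f \<subseteq> X}"
  assumes D: "stanley_decomposition (*) I (\<lambda>a. I \<inter> hom_comp a) D"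
    and full: "\<forall>(m, Z)\<in>set D. Z = UNIV" and X: "X \<noteq> {}"
  shows "\<exists>w\<in>X. \<forall>e\<in>X. w \<preceq> e"
proof -
  let ?x = "\<lambda>u. Poly_Mapping.single u (1::'k)"
  have surj: "(\<lambda>v. \<Sum>i<length D. v i) `
      PiE {..<length D} (\<lambda>i. stanley_space (*) (fst (D ! i)) (snd (D ! i))) = I"
    using D unfolding stanley_decomposition_def direct_sum_of_def bij_betw_def by blast
  \<comment> \<open>The empty list decomposes only the zero ideal, which
    \<open>X \<noteq> {}\<close> excludes.\<close>
  have "D \<noteq> []"
  proof
    assume "D = []"
    with surj have "I = {0}"
      by simp
    moreover from X obtain e where "e \<in> X"
      by blast
    then have "?x e \<in> I"
      by (simp add: I_def)
    ultimately have "?x e = 0"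
      by blast
    then have "Poly_Mapping.lookup (?x e) e = 0"
      by simp
    then show False
      by simp
  qed
  with stanley_decomposition_full[OF D full] have "length D = Suc 0"
    by (cases D) auto
  then obtain m Z where DmZ: "D = [(m, Z)]"
    by (auto simp: length_Suc_conv)
  obtain a where m: "m \<in> I" "m \<in> hom_comp a" "m \<noteq> 0"
    using D free_stanley_space_nonzero unfolding stanley_decomposition_def DmZ by auto
  from \<open>m \<noteq> 0\<close> obtain w where w: "w \<in> Poly_Mapping.keys m"
    by (metis in_keys_iff lookup_zero poly_mapping_eqI)
  \<comment> \<open>The degree \<open>a\<close> fixes every coordinate of an exponent of
    \<open>m\<close>.\<close>
  have keys_m: "u = w" if "u \<in> Poly_Mapping.keys m" for u
  proof (rule poly_mapping_eqI)
    fix i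
    have "int (Poly_Mapping.lookup u i) = int (Poly_Mapping.lookup w i)"
      using m(2) w that by (simp add: hom_comp_def)
    then show "Poly_Mapping.lookup u i = Poly_Mapping.lookup w i"
      by simp
  qed
  have "w \<preceq> e" if "e \<in> X" for e
  proof -
    have "?x e \<in> I"
      using that by (simp add: I_def)
    then obtain f where "?x e = f * m"
      unfolding surj[symmetric] by (auto simp: DmZ stanley_space_def PiE_iff lessThan_Suc)
    then have "e \<in> Poly_Mapping.keys (f * m)"
      by (metis in_keys_iff lookup_single_eq one_neq_zero)
    then obtain b u where "e = b + u" "u \<in> Poly_Mapping.keys m"
      using keys_mult[of f m] by blast
    then show ?thesis
      using keys_m[of u] by (simp add: add.commute[of b])
  qed
  moreover have "w \<in> X"
    using m(1) w by (auto simp: I_def)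
  ultimately show ?thesis
    by blast
qed

section \<open>Both bounds for three generators\<close>

theorem theorem2p4:
  fixes I :: "('n::finite, 'k::field) mpoly set"
  assumes "monomial_ideal I"
    and "card (min_mon_gens I) = 3"
  shows "ideal_sdepth I = CARD('n) - 1"
proof -
  let ?x = "\<lambda>u::'n \<Rightarrow>\<^sub>0 nat. Poly_Mapping.single u (1::'k)"
  let ?gr = "\<lambda>a. I \<inter> hom_comp a"
  define G where "G = min_mon_gens I"
  have G: "is_min_mon_gens I G"
    unfolding G_def min_mon_gens_def by (rule theI'[OF ex1_min_mon_gens[OF assms(1)]])
  obtain g1 g2 g3 where g: "G = {g1, g2, g3}" "g1 \<noteq> g2"
    using assms(2) unfolding G_def[symmetric] card_3_iff by blast
  obtain u1 u2 u3 where u: "g1 = ?x u1" "g2 = ?x u2" "g3 = ?x u3"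
    using G g unfolding is_min_mon_gens_def monomials_def by auto
  define E where "E = {u1, u2, u3}"
  have GE: "G = ?x ` E"
    using g u by (simp add: E_def)
  define X where "X = {e. \<exists>u\<in>E. u \<preceq> e}"
  have "X \<noteq> {}"
    unfolding X_def E_def using exp_le_refl by blast
  have I: "I = {f. Poly_Mapping.keys f \<subseteq> X}"
    using G ideal_gen_singles[of E, where 'k = 'k] unfolding is_min_mon_gens_def GE X_def by simp
  \<comment> \<open>A least exponent would let one generator generate \<open>I\<close> alone; since
    \<open>g1 \<noteq> g2\<close>, this contradicts minimality of \<open>G\<close>.\<close>
  have no_least: "\<not> (\<exists>w\<in>X. \<forall>e\<in>X. w \<preceq> e)"
  proof
    assume "\<exists>w\<in>X. \<forall>e\<in>X. w \<preceq> e"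
    then obtain w u where w: "\<forall>e\<in>X. w \<preceq> e" and u': "u \<in> E" "u \<preceq> w"
      unfolding X_def by blast
    have "ideal_gen {?x u} = {f. Poly_Mapping.keys f \<subseteq> {e. u \<preceq> e}}"
      using ideal_gen_singles[of "{u}", where 'k = 'k] by simp
    moreover have "{e. u \<preceq> e} = X"
      using w u' exp_le_trans unfolding X_def by blast
    ultimately have "ideal_gen {?x u} = I"
      by (simp add: I)
    moreover have "{?x u} \<subset> G"
      using u' g GE by auto
    ultimately show False
      using G unfolding is_min_mon_gens_def by blast
  qed
  \<comment> \<open>Some summand must omit a variable, and it bounds the minimum.\<close>
  have le: "decomp_sdepth D \<le> CARD('n) - 1" if D: "stanley_decomposition (*) I ?gr D" for D
  proof -
    have "\<not> (\<forall>(m, Z)\<in>set D. Z = UNIV)"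
      using stanley_decomposition_full_least_exponent[of X D, folded I] D no_least \<open>X \<noteq> {}\<close> by blast
    then obtain m Z where mZ: "(m, Z) \<in> set D" "Z \<noteq> UNIV"
      by blast
    then have "card Z < CARD('n)"
      by (intro psubset_card_mono) auto
    moreover have "decomp_sdepth D \<le> card Z"
      unfolding decomp_sdepth_def using mZ by (intro Min_le) force+
    ultimately show ?thesis
      by simp
  qed
  have "X = {e. u1 \<preceq> e \<or> u2 \<preceq> e \<or> u3 \<preceq> e}"
    by (auto simp: X_def E_def)
  then obtain D where D: "stanley_decomposition (*) I ?gr D"
      "\<forall>(m, Z)\<in>set D. CARD('n) - 1 \<le> card Z"
    using ex_box_partition_above_three[of u1 u2 u3] stanley_decomposition_of_box_partition[OF I]
    by metis
  \<comment> \<open>For the empty list the condition \<open>Z = UNIV\<close> holds vacuously, so the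
    same lemma would give a least exponent. Nonemptiness makes \<open>Min\<close>
    meaningful.\<close>
  have "D \<noteq> []"
    using stanley_decomposition_full_least_exponent[of X D, folded I] D(1) no_least \<open>X \<noteq> {}\<close>
    by force
  then have "CARD('n) - 1 \<le> decomp_sdepth D"
    unfolding decomp_sdepth_def using D(2) by (intro Min.boundedI) auto
  with le[OF D(1)] have D_eq: "decomp_sdepth D = CARD('n) - 1"
    by simp
  let ?S = "{decomp_sdepth D |D. stanley_decomposition (*) I ?gr D}"
  have "Max ?S = CARD('n) - 1"
  proof (rule Max_eqI)
    \<comment> \<open>The upper bound also gives the finiteness on which \<open>Max\<close>
      relies.\<close>
    show "finite ?S"
      by (rule finite_subset[of _ "{..CARD('n) - 1}"]) (use le in auto)
    show "CARD('n) - 1 \<in> ?S"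
      using D(1) D_eq by force
  qed (use le in auto)
  then show ?thesis
    by (simp add: ideal_sdepth_def sdepth_def)
qed

end
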